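(* Let $k$ be a nonnegative integer, let $G=(V,E)$ be a connected graph and let $P_1,\ldots,P_r$ be a partition of $V$. Then \[\gamma_{P,k}(G)\leq \sum_{i=1}^r \gamma_{P,k}(\widehat{P_i}).\]
   Context: Graphs are finite, simple and undirected; $N(v)$ is the open neighborhood and $N[S]=\bigcup_{v\in S}(N(v)\cup\{v\})$. For $X\subseteq V$, $\widehat X$ is the graph obtained from the induced subgraph $G[X]$ by attaching to each vertex $x\in X$ as many new pendent vertices as $x$ has neighbors in $G-X$. For a graph $G=(V,E)$, nonnegative integer $k$ and $S\subseteq V$, define $\mathscr P^0_{G,k}(S)=N[S]$ and $\mathscr P^{i+1}_{G,k}(S)=\mathscr P^i_{G,k}(S)\cup\bigcup\{N(v): v\in \mathscr P^i_{G,k}(S),\ 1\le |N(v)\setminus \mathscr P^i_{G,k}(S)|\le k\}$. $S$ is a $k$-power dominating set of $G$ if $\mathscr P^\ell_{G,k}(S)=V$ for some $\ell$; $\gamma_{P,k}(G)$ is the minimum size of such a set. *)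

theory Defs
  imports "Graph_Theory.Graph_Theory" "HOL-Library.Disjoint_Sets"
begin

text \<open>
  A finite simple undirected graph is a \<^locale>\<open>pair_graph\<close>: a finite symmetric loop-free
  digraph without parallel arcs, each edge being a pair of opposite arcs. Note that
  \<^const>\<open>connected\<close> (from Graph_Theory) implies that there is at least one vertex.
\<close>

definition neighbors :: "'a pair_pre_digraph \<Rightarrow> 'a \<Rightarrow> 'a set" where
  "neighbors G v = {w \<in> pverts G. (v, w) \<in> parcs G}"

definition closed_neighbors :: "'a pair_pre_digraph \<Rightarrow> 'a set \<Rightarrow> 'a set" where
  "closed_neighbors G S = (\<Union>v\<in>S. neighbors G v \<union> {v})"

primrec monitored :: "'a pair_pre_digraph \<Rightarrow> nat \<Rightarrow> nat \<Rightarrow> 'a set \<Rightarrow> 'a set" where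
  "monitored G k 0 S = closed_neighbors G S"
| "monitored G k (Suc i) S = monitored G k i S \<union>
     \<Union>{neighbors G v | v. v \<in> monitored G k i S \<and>
         1 \<le> card (neighbors G v - monitored G k i S) \<and>
         card (neighbors G v - monitored G k i S) \<le> k}"

definition power_dominating :: "'a pair_pre_digraph \<Rightarrow> nat \<Rightarrow> 'a set \<Rightarrow> bool" where
  "power_dominating G k S \<longleftrightarrow> S \<subseteq> pverts G \<and> (\<exists>l. monitored G k l S = pverts G)"

definition power_domination_number :: "nat \<Rightarrow> 'a pair_pre_digraph \<Rightarrow> nat" where
  "power_domination_number k G = (LEAST n. \<exists>S. power_dominating G k S \<and> card S = n)"

text \<open>
  The graph obtained from the subgraph induced by \<open>X\<close> by attaching pendent vertices: a vertex
  \<open>x\<close> of \<open>X\<close> is represented by \<open>Inl x\<close>, and its new pendent vertices are the \<open>Inr (x, y)\<close>, one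
  for each neighbor \<open>y\<close> of \<open>x\<close> outside \<open>X\<close>. Pendent vertices at distinct \<open>x\<close> are distinct, even
  if they arise from the same \<open>y\<close>.
\<close>

definition pendent_extension ::
    "'a pair_pre_digraph \<Rightarrow> 'a set \<Rightarrow> ('a + 'a \<times> 'a) pair_pre_digraph" where
  "pendent_extension G X =
     \<lparr> pverts = Inl ` verts (with_proj G \<restriction> X) \<union> {Inr (x, y) | x y. x \<in> X \<and> y \<in> neighbors G x - X},
       parcs = {(Inl x, Inl y) | x y. (x, y) \<in> arcs (with_proj G \<restriction> X)}
         \<union> {(Inl x, Inr (x, y)) | x y. x \<in> X \<and> y \<in> neighbors G x - X}
         \<union> {(Inr (x, y), Inl x) | x y. x \<in> X \<and> y \<in> neighbors G x - X} \<rparr>"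

lemma pair_graph_pendent_extension:
  assumes "pair_graph G" and "X \<subseteq> pverts G"
  shows "pair_graph (pendent_extension G X)"
proof -
  interpret pair_graph G by fact
  have fin: "finite X" using assms(2) pair_finite_verts by (rule finite_subset)
  have fin': "finite {(x, y) | x y. x \<in> X \<and> y \<in> neighbors G x - X}" (is "finite ?B")
    by (rule finite_subset[of _ "X \<times> pverts G"])
      (use fin pair_finite_verts in \<open>auto simp: neighbors_def\<close>)
  have P: "{Inr (x, y) :: 'a + 'a \<times> 'a | x y. x \<in> X \<and> y \<in> neighbors G x - X} = Inr ` ?B"
    by auto
  have fv: "finite (pverts (pendent_extension G X))"
    using fin fin' unfolding pendent_extension_def by (simp add: P del: Diff_iff)
  have wf: "fst e \<in> pverts (pendent_extension G X) \<and> snd e \<in> pverts (pendent_extension G X)"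
    if "e \<in> parcs (pendent_extension G X)" for e
    using that by (auto simp: pendent_extension_def)
  have fa: "finite (parcs (pendent_extension G X))"
    by (rule finite_subset[of _ "pverts (pendent_extension G X) \<times> pverts (pendent_extension G X)"])
      (use wf fv in \<open>auto simp: mem_Times_iff\<close>)
  have sym: "sym (parcs G)"
    using pair_sym_arcs by (simp add: symmetric_def)
  have "sym (parcs (pendent_extension G X))"
    by (rule symI) (auto simp: pendent_extension_def dest: symD[OF sym])
  then have s: "symmetric (with_proj (pendent_extension G X))"
    by (simp add: symmetric_def)
  have l: "fst e \<noteq> snd e" if "e \<in> parcs (pendent_extension G X)" for e
    using that pair_no_loops by (auto simp: pendent_extension_def)
  show ?thesis
    by unfold_locales (use wf fv fa s l in auto)
qed

lemma power_dominating_pverts: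
  assumes "pair_graph G"
  shows "power_dominating G k (pverts G)"
  unfolding power_dominating_def
  by (auto intro!: exI[of _ 0] simp: closed_neighbors_def neighbors_def)

end

theory Submission
  imports Defs
begin

text \<open>
  Map the vertices of the graph obtained from the part \<open>X\<close> to \<open>G\<close> by \<open>Inl x \<mapsto> x\<close> and
  \<open>Inr (x, y) \<mapsto> y\<close>. This is a bijection from the neighborhood of \<open>Inl x\<close> to that of \<open>x\<close>, so a
  propagation step at \<open>Inl x\<close> can be imitated at \<open>x\<close>. A pendent vertex is never monitored before
  the vertex carrying it, so it contributes no propagation of its own; as an initial vertex, it
  can be replaced by its carrier. Hence the union of power dominating sets for the parts, with
  pendent vertices replaced by their carriers, is power dominating for \<open>G\<close>.
\<close>

lemma mem_closed_neighbors_iff: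
  "v \<in> closed_neighbors G S \<longleftrightarrow> (\<exists>s\<in>S. v = s \<or> v \<in> neighbors G s)"
  by (auto simp: closed_neighbors_def)

lemma mem_monitored_Suc_iff:
  "u \<in> monitored G k (Suc j) S \<longleftrightarrow> u \<in> monitored G k j S \<or>
     (\<exists>v\<in>monitored G k j S. u \<in> neighbors G v \<and>
        1 \<le> card (neighbors G v - monitored G k j S) \<and>
        card (neighbors G v - monitored G k j S) \<le> k)"
  by auto

lemma monitored_subset_pverts:
  assumes "S \<subseteq> pverts G"
  shows "monitored G k j S \<subseteq> pverts G"
  using assms by (induction j) (auto simp: closed_neighbors_def neighbors_def)

lemma monitored_mono:
  assumes "i \<le> j"
  shows "monitored G k i S \<subseteq> monitored G k j S"
  using assms by (rule lift_Suc_mono_le[rotated]) auto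

lemma finite_neighbors:
  assumes "pair_graph G"
  shows "finite (neighbors G v)"
proof -
  interpret pair_graph G by fact
  show ?thesis
    unfolding neighbors_def using pair_finite_verts by simp
qed

lemma neighbors_subset_monitored_Suc:
  assumes "finite (neighbors G v)" and "v \<in> monitored G k j S"
    and "card (neighbors G v - monitored G k j S) \<le> k"
  shows "neighbors G v \<subseteq> monitored G k (Suc j) S"
proof (cases "neighbors G v \<subseteq> monitored G k j S")
  case False
  then have "1 \<le> card (neighbors G v - monitored G k j S)"
    using assms(1) by (metis Diff_eq_empty_iff One_nat_def Suc_leI card_gt_0_iff finite_Diff)
  then show ?thesis
    using assms(2,3) by (auto simp del: monitored.simps simp: mem_monitored_Suc_iff)
qed auto

lemma power_domination_number_le:
  assumes "power_dominating G k S"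
  shows "power_domination_number k G \<le> card S"
  unfolding power_domination_number_def using assms by (intro Least_le) blast

text \<open>The \<open>LEAST\<close> is attained because the whole vertex set is power
  dominating.\<close>

lemma power_domination_number_witness:
  assumes "pair_graph G"
  obtains S where "power_dominating G k S" and "card S = power_domination_number k G"
proof -
  have "\<exists>n S. power_dominating G k S \<and> card S = n"
    using power_dominating_pverts[OF assms] by blast
  from LeastI_ex[OF this] show thesis
    using that unfolding power_domination_number_def by blast
qed

lemma pverts_pendent_extension:
  "pverts (pendent_extension G X) =
     Inl ` X \<union> {Inr (x, y) | x y. x \<in> X \<and> y \<in> neighbors G x - X}"
  by (simp add: pendent_extension_def)

lemma neighbors_pendent_extension_Inl:
  assumes "x \<in> X" and "X \<subseteq> pverts G"
  shows "neighbors (pendent_extension G X) (Inl x) =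
    Inl ` (neighbors G x \<inter> X) \<union> (\<lambda>y. Inr (x, y)) ` (neighbors G x - X)"
  using assms by (auto simp: neighbors_def pendent_extension_def)

lemma neighbors_pendent_extension_Inr:
  "neighbors (pendent_extension G X) (Inr (x, y)) =
    (if x \<in> X \<and> y \<in> neighbors G x - X then {Inl x} else {})"
  by (auto simp: neighbors_def pendent_extension_def)

text \<open>Neighbors of \<open>x\<close> inside \<open>X\<close> come from \<open>Inl\<close>,
  those outside from the pendent vertices at \<open>x\<close>. This lifts each neighbor of
  \<open>x\<close> in \<open>G\<close> to a neighbor of \<open>Inl x\<close>, which is what bounding
  unmonitored neighbors in \<open>G\<close> requires.\<close>

lemma case_sum_image_neighbors_pendent_extension:
  assumes "x \<in> X" and "X \<subseteq> pverts G"
  shows "case_sum id snd ` neighbors (pendent_extension G X) (Inl x) = neighbors G x"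
  unfolding neighbors_pendent_extension_Inl[OF assms] by (auto simp: image_Un image_image)

lemma Inr_mem_neighbors_pendent_extensionD:
  assumes "Inr (x, y) \<in> neighbors (pendent_extension G X) v"
  shows "v = Inl x"
  using assms by (auto simp: neighbors_def pendent_extension_def)

text \<open>The carrier is the only neighbor of a pendent vertex. So the pendent vertex either lies
  in \<open>S\<close>, which puts its carrier into the closed neighborhood of \<open>S\<close>, or
  is reached from the carrier itself.\<close>

lemma monitored_pendent_extension_carrier:
  assumes "S \<subseteq> pverts (pendent_extension G X)"
    and "Inr (x, y) \<in> monitored (pendent_extension G X) k j S"
  shows "Inl x \<in> monitored (pendent_extension G X) k j S"
  using assms(2)
proof (induction j)
  case 0
  then obtain s where s: "s \<in> S" "Inr (x, y) = s \<or> Inr (x, y) \<in> neighbors (pendent_extension G X) s"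
    by (auto simp: mem_closed_neighbors_iff)
  from s(2) show ?case
  proof
    assume "Inr (x, y) = s"
    moreover have "s \<in> pverts (pendent_extension G X)"
      using s(1) assms(1) by blast
    ultimately have "Inl x \<in> neighbors (pendent_extension G X) s"
      by (auto simp: pverts_pendent_extension neighbors_pendent_extension_Inr)
    then show ?thesis
      using s(1) by (auto simp: mem_closed_neighbors_iff)
  next
    assume "Inr (x, y) \<in> neighbors (pendent_extension G X) s"
    then show ?thesis
      using s(1) Inr_mem_neighbors_pendent_extensionD by (force simp: mem_closed_neighbors_iff)
  qed
next
  case (Suc j)
  then show ?case
    by (auto simp del: monitored.simps simp: mem_monitored_Suc_iff
        dest: Inr_mem_neighbors_pendent_extensionD)
qed

text \<open>Two maps occur: \<open>fst\<close> moves an initial pendent vertex to its carrier, while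
  \<open>snd\<close> sends a monitored one to the outside neighbor it stands for. Only an inclusion
  in \<open>T\<close> is required, so that one \<open>T\<close> can serve all parts at once.\<close>

lemma monitored_pendent_extension_image:
  assumes "pair_graph G" and X: "X \<subseteq> pverts G"
    and S: "S \<subseteq> pverts (pendent_extension G X)"
    and T: "case_sum id fst ` S \<subseteq> T"
  shows "case_sum id snd ` monitored (pendent_extension G X) k j S \<subseteq> monitored G k j T"
proof (induction j)
  case 0
  show ?case
  proof
    fix z assume "z \<in> case_sum id snd ` monitored (pendent_extension G X) k 0 S"
    then obtain s u where s: "s \<in> S" and u: "u = s \<or> u \<in> neighbors (pendent_extension G X) s"
      and z: "z = case_sum id snd u"
      unfolding monitored.simps image_iff Bex_def mem_closed_neighbors_iff by blast
    have sV: "s \<in> pverts (pendent_extension G X)" using s S by blast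
    have sT: "case_sum id fst s \<in> T" using s T by blast
    have "z = case_sum id fst s \<or> z \<in> neighbors G (case_sum id fst s)"
    proof (cases s)
      case (Inl x)
      with sV have "x \<in> X" by (auto simp: pverts_pendent_extension)
      then show ?thesis
        using u z Inl case_sum_image_neighbors_pendent_extension[OF _ X, of x] by auto
    next
      \<comment> \<open>For \<open>s = Inr (x, y)\<close>, the closed neighborhood of
        \<open>s\<close> maps to \<open>y\<close> and \<open>x\<close>, both in the closed
        neighborhood of \<open>x\<close> in \<open>G\<close>.\<close>
      case (Inr p)
      with sV u z show ?thesis
        by (cases p) (auto simp: pverts_pendent_extension neighbors_pendent_extension_Inr)
    qed
    with sT show "z \<in> monitored G k 0 T"
      by (auto simp: mem_closed_neighbors_iff)
  qed
next
  case (Suc j)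
  let ?H = "pendent_extension G X"
  let ?M = "monitored ?H k j S"
  let ?f = "case_sum id snd :: 'a + 'a \<times> 'a \<Rightarrow> 'a"
  have finH: "finite (neighbors ?H v)" for v
    by (intro finite_neighbors pair_graph_pendent_extension assms)
  show ?case
  proof
    fix z assume "z \<in> ?f ` monitored ?H k (Suc j) S"
    then obtain u where u: "u \<in> monitored ?H k (Suc j) S" and z: "z = ?f u"
      by blast
    show "z \<in> monitored G k (Suc j) T"
    proof (cases "u \<in> ?M")
      case True
      with Suc z show ?thesis by auto
    next
      case False
      with u obtain v where v: "v \<in> ?M" "u \<in> neighbors ?H v" and c: "card (neighbors ?H v - ?M) \<le> k"
        unfolding mem_monitored_Suc_iff by blast
      \<comment> \<open>A pendent \<open>v\<close> could only propagate to its carrier, which is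
        already monitored, whereas \<open>u\<close> is new.\<close>
      obtain x where x: "v = Inl x"
      proof (cases v)
        case (Inr p)
        obtain a b where "p = (a, b)" by (cases p)
        with v Inr have "u = Inl a" "Inr (a, b) \<in> ?M"
          by (auto simp: neighbors_pendent_extension_Inr split: if_splits)
        with monitored_pendent_extension_carrier[OF S] False show thesis by blast
      qed
      have "v \<in> pverts ?H"
        using v(1) monitored_subset_pverts[OF S] by blast
      then have "x \<in> X"
        using x by (auto simp: pverts_pendent_extension)
      note N = case_sum_image_neighbors_pendent_extension[OF this X]
      \<comment> \<open>By the induction hypothesis, a lift of an unmonitored neighbor of
        \<open>x\<close> cannot lie in \<open>?M\<close>.\<close>
      have "neighbors G x - monitored G k j T \<subseteq> ?f ` (neighbors ?H v - ?M)"
        using Suc x unfolding N[symmetric] by blast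
      then have "card (neighbors G x - monitored G k j T) \<le> k"
        using c surj_card_le finH by (meson finite_Diff order_trans)
      moreover have "x \<in> monitored G k j T"
        using Suc v(1) x by force
      ultimately have "neighbors G x \<subseteq> monitored G k (Suc j) T"
        by (intro neighbors_subset_monitored_Suc finite_neighbors assms(1))
      moreover have "z \<in> neighbors G x"
        using N v(2) x z by blast
      ultimately show ?thesis by blast
    qed
  qed
qed

theorem theorem4p9:
  fixes k r :: nat
    and G :: "'a pair_pre_digraph"
    and P :: "nat \<Rightarrow> 'a set"
  assumes "pair_graph G"
    and "connected (with_proj G)"
    and "(\<Union>i\<in>{1..r}. P i) = pverts G"
    and "disjoint_family_on P {1..r}"
    and "\<And>i. i \<in> {1..r} \<Longrightarrow> P i \<noteq> {}"
  shows "power_domination_number k G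
    \<le> (\<Sum>i=1..r. power_domination_number k (pendent_extension G (P i)))"
proof -
  let ?H = "\<lambda>i. pendent_extension G (P i)"
  let ?p = "case_sum id fst :: 'a + 'a \<times> 'a \<Rightarrow> 'a"
  have X: "P i \<subseteq> pverts G" if "i \<in> {1..r}" for i
    using that assms(3) by blast
  have gr: "pair_graph (?H i)" if "i \<in> {1..r}" for i
    by (rule pair_graph_pendent_extension[OF assms(1) X[OF that]])
  have "\<forall>i\<in>{1..r}. \<exists>S. power_dominating (?H i) k S \<and> card S = power_domination_number k (?H i)"
    using gr power_domination_number_witness by metis
  then obtain S where S: "\<And>i. i \<in> {1..r} \<Longrightarrow> power_dominating (?H i) k (S i)"
    and card_S: "\<And>i. i \<in> {1..r} \<Longrightarrow> card (S i) = power_domination_number k (?H i)"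
    by metis
  have "\<forall>i\<in>{1..r}. \<exists>l. monitored (?H i) k l (S i) = pverts (?H i)"
    using S unfolding power_dominating_def by blast
  then obtain l where l: "\<And>i. i \<in> {1..r} \<Longrightarrow> monitored (?H i) k (l i) (S i) = pverts (?H i)"
    by metis
  have SV: "S i \<subseteq> pverts (?H i)" if "i \<in> {1..r}" for i
    using S[OF that] unfolding power_dominating_def by blast
  have fin: "finite (S i)" if "i \<in> {1..r}" for i
  proof -
    interpret pair_graph "?H i" by (rule gr[OF that])
    show ?thesis using SV[OF that] pair_finite_verts by (rule finite_subset)
  qed
  define T where "T = (\<Union>i\<in>{1..r}. ?p ` S i)"
  \<comment> \<open>Monitored sets grow with time, so the largest of the times \<open>l i\<close>
    serves every part. For \<open>r = 0\<close> there is no vertex to monitor, so the unspecified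
    \<open>Max\<close> does no harm.\<close>
  define L where "L = Max (l ` {1..r})"
  have "?p ` S i \<subseteq> P i" if "i \<in> {1..r}" for i
    using SV[OF that] by (force simp: pverts_pendent_extension)
  then have T: "T \<subseteq> pverts G"
    unfolding T_def assms(3)[symmetric] by blast
  have "pverts G \<subseteq> monitored G k L T"
  proof
    fix x assume "x \<in> pverts G"
    then obtain i where i: "i \<in> {1..r}" "x \<in> P i" using assms(3) by blast
    then have "Inl x \<in> monitored (?H i) k (l i) (S i)"
      by (simp add: l pverts_pendent_extension)
    then have "x \<in> case_sum id snd ` monitored (?H i) k (l i) (S i)"
      by (force intro: rev_image_eqI)
    also have "\<dots> \<subseteq> monitored G k (l i) T"
      using i by (intro monitored_pendent_extension_image assms(1) X SV) (auto simp: T_def)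
    also have "\<dots> \<subseteq> monitored G k L T"
      using i by (intro monitored_mono) (simp add: L_def)
    finally show "x \<in> monitored G k L T" .
  qed
  then have "power_dominating G k T"
    unfolding power_dominating_def using T monitored_subset_pverts[OF T] by blast
  then have "power_domination_number k G \<le> card T"
    by (rule power_domination_number_le)
  also have "\<dots> \<le> (\<Sum>i=1..r. card (?p ` S i))"
    unfolding T_def by (rule card_UN_le) simp
  \<comment> \<open>Moving pendent vertices to their carriers can merge elements but never adds
    any.\<close>
  also have "\<dots> \<le> (\<Sum>i=1..r. card (S i))"
    by (intro sum_mono card_image_le fin)
  finally show ?thesis
    by (simp add: card_S)
qed

end
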